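(* Let $(\mathcal{P},+,\times,\preccurlyeq)$ be the partially ordered semiring of propositions, with additive identity $\top$ and multiplicative identity $\bot$, where $\top\preccurlyeq p\preccurlyeq\bot$ for all $p\in\mathcal{P}$. Then for all $p,q,r\in\mathcal{P}$: (i) if $p+q\preccurlyeq r$, then $p\preccurlyeq r$ and $q\preccurlyeq r$; and (ii) if $p\preccurlyeq q\times r$, then $p\preccurlyeq q$ and $p\preccurlyeq r$.
   Context: $\mathcal{P}$ is the set of propositions of a Boolean propositional algebra (a Boolean algebra with operations $\wedge,\vee,\neg$). Write $p+q:=p\wedge q$ and $p\times q:=p\vee q$. The additive identity is $\top$ (the always-true proposition) and the multiplicative identity is $\bot$ (the always-false proposition). With these, $(\mathcal{P},+,\times)$ is a commutative semiring with zero $\top$ and one $\bot$. The partially ordered semiring $(\mathcal{P},+,\times,\preccurlyeq)$ is this semiring together with a partial order $\preccurlyeq$ on $\mathcal{P}$ such that for all $p,q,r\in\mathcal{P}$: $p\preccurlyeq q$ implies $p+r\preccurlyeq q+r$ (monotony law of addition), and $p\preccurlyeq q$ implies $p\times r\preccurlyeq q\times r$ (monotony law of multiplication). It is also assumed that $\top\preccurlyeq p$ and $p\preccurlyeq\bot$ for all $p\in\mathcal{P}$. *)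

theory Defs
  imports Main
begin

text \<open>
  A commutative semiring with a partial order for which addition and multiplication are monotone.
  The class predicate \<open>comm_semiring_1\<close> is avoided because it also demands
  \<open>zero \<noteq> one\<close>, which would exclude the degenerate Boolean algebra.
\<close>

locale partially_ordered_semiring =
  fixes add :: "'a \<Rightarrow> 'a \<Rightarrow> 'a"  (infixl "\<^bold>+" 65)
    and zero :: 'a
    and mul :: "'a \<Rightarrow> 'a \<Rightarrow> 'a"  (infixl "\<^bold>\<times>" 70)
    and one :: 'a
    and le :: "'a \<Rightarrow> 'a \<Rightarrow> bool"  (infix "\<preceq>" 50)
  assumes additive: "class.comm_semiring_0 (\<^bold>+) zero (\<^bold>\<times>)"
    and multiplicative: "class.comm_monoid_mult (\<^bold>\<times>) one"
    and le_refl: "p \<preceq> p"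
    and le_trans: "p \<preceq> q \<Longrightarrow> q \<preceq> r \<Longrightarrow> p \<preceq> r"
    and le_antisym: "p \<preceq> q \<Longrightarrow> q \<preceq> p \<Longrightarrow> p = q"
    and add_mono: "p \<preceq> q \<Longrightarrow> p \<^bold>+ r \<preceq> q \<^bold>+ r"
    and mul_mono: "p \<preceq> q \<Longrightarrow> p \<^bold>\<times> r \<preceq> q \<^bold>\<times> r"

text \<open>
  Propositions form an arbitrary Boolean algebra. Semiring addition is conjunction and semiring
  multiplication is disjunction, so \<open>top\<close> is the zero and \<open>bot\<close> the one.
\<close>

abbreviation prop_add :: "'a::boolean_algebra \<Rightarrow> 'a \<Rightarrow> 'a"  (infixl "\<^bold>+" 65)
  where "p \<^bold>+ q \<equiv> inf p q"

abbreviation prop_mul :: "'a::boolean_algebra \<Rightarrow> 'a \<Rightarrow> 'a"  (infixl "\<^bold>\<times>" 70)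
  where "p \<^bold>\<times> q \<equiv> sup p q"

text \<open>
  The semiring axioms hold in every Boolean algebra, so for propositions the locale only
  constrains the order.
\<close>

lemma prop_comm_semiring_0:
  "class.comm_semiring_0 prop_add (top :: 'a::boolean_algebra) prop_mul"
  by unfold_locales (rule inf.assoc inf.commute sup.assoc sup.commute sup_inf_distrib2 | simp)+

lemma prop_comm_monoid_mult:
  "class.comm_monoid_mult prop_mul (bot :: 'a::boolean_algebra)"
  by unfold_locales (auto simp: ac_simps)

text \<open>
  The order of the semiring is not the order \<open>\<le>\<close> of the type class: since \<open>top\<close> is to be
  the least element, its prototype is the reverse of \<open>\<le>\<close>.
\<close>

lemma prop_partially_ordered_semiring:
  "partially_ordered_semiring prop_add (top :: 'a::boolean_algebra) prop_mul bot (\<ge>)"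
  by (intro partially_ordered_semiring.intro prop_comm_semiring_0 prop_comm_monoid_mult)
    (auto intro: le_infI1 le_supI1)

end

theory Submission
  imports Defs
begin

text \<open>In the order \<open>\<preceq>\<close>, adding never lowers a proposition, because the
  additive identity \<open>top\<close> is least; multiplying never raises one, because the
  multiplicative identity \<open>bot\<close> is greatest. Chaining these bounds with the hypotheses
  gives both claims.\<close>

theorem theorem3p3:
  fixes le :: "'a::boolean_algebra \<Rightarrow> 'a \<Rightarrow> bool"  (infix "\<preceq>" 50)
  assumes "partially_ordered_semiring (\<^bold>+) (top :: 'a) (\<^bold>\<times>) bot (\<preceq>)"
    and "\<forall>p. top \<preceq> p \<and> p \<preceq> bot"
  shows "\<forall>p q r. (p \<^bold>+ q \<preceq> r \<longrightarrow> p \<preceq> r \<and> q \<preceq> r) \<and>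
                 (p \<preceq> q \<^bold>\<times> r \<longrightarrow> p \<preceq> q \<and> p \<preceq> r)"
proof -
  interpret partially_ordered_semiring "(\<^bold>+)" "top :: 'a" "(\<^bold>\<times>)" bot "(\<preceq>)"
    by (fact assms(1))
  \<comment> \<open>Add \<open>p\<close> to both sides of \<open>top \<preceq> q\<close>.\<close>
  have add_upper: "p \<preceq> inf p q" for p q
    using add_mono[of top q p] assms(2) by (simp add: inf.commute)
  \<comment> \<open>Dually, multiply \<open>q \<preceq> bot\<close> by \<open>p\<close>.\<close>
  have mul_lower: "sup p q \<preceq> p" for p q
    using mul_mono[of q bot p] assms(2) by (simp add: sup.commute)
  \<comment> \<open>Commutativity carries both bounds over to the second operand.\<close>
  show ?thesis
    by (metis add_upper mul_lower le_trans inf.commute sup.commute)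
qed

end
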